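(* Let $e\ge 3$ be an odd integer with $e\equiv 1 \pmod 4$, let $q=2^e$, and let $\mathcal{C}^3_\varepsilon:=\mathcal{C}(\mathcal{V}^3_\varepsilon)$ be the projective code over $\mathbb{F}_{q^2}$ generated by the point set $\mathcal{V}^3_\varepsilon\subset\mathrm{PG}(3,q^2)$ (defined in the context, with $r=3$). Then the weights of the non-zero codewords of $\mathcal{C}^3_\varepsilon$ belong to the set $$\{q^5,\ q^5-q^3,\ q^5-q^3+q^2,\ q^5-q^3+q,\ q^5-q^3+q^2+q\}.$$
   Context: Let $e\ge 3$ be odd, $q=2^e$, $r\ge 2$. Points of $\mathrm{PG}(r,q^2)$ (projective space of projective dimension $r$ over $\mathbb{F}_{q^2}$) have homogeneous coordinates $(X_0,\dots,X_r)$; $\Pi_\infty$ is the hyperplane $X_0=0$, and affine coordinates on the complement $\mathrm{AG}(r,q^2)$ are $x_i=X_i/X_0$. For an exponent involving $\sigma$, $\sigma$ stands for $2^{(e+1)/2}$, i.e. $x^{\sigma}=x^{2^{(e+1)/2}}$ and $x^{\sigma+2}=x^{2^{(e+1)/2}+2}$. Fix $\varepsilon\in\mathbb{F}_{q^2}\setminus\mathbb{F}_q$ such that $\varepsilon^2+\varepsilon+\delta=0$ for some $\delta\in\mathbb{F}_q\setminus\{1\}$ with absolute trace $\mathrm{Tr}_{q/2}(\delta)=\sum_{i=0}^{e-1}\delta^{2^i}=1$. Put $$\Gamma_{\varepsilon}(x)=[x+(x^q+x)\varepsilon]^{\sigma+2}+(x^q+x)^{\sigma}+(x^{2q}+x^2)\varepsilon+x^{q+1}+x^2.$$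 $\mathcal{V}^r_\varepsilon$ is the projective hypersurface of $\mathrm{PG}(r,q^2)$ with affine equation $x_r^q+x_r=\Gamma_{\varepsilon}(x_1)+\dots+\Gamma_{\varepsilon}(x_{r-1})$, i.e. the zero locus of the homogenization (with respect to $X_0$) of the corresponding polynomial; it is identified with its set of $\mathbb{F}_{q^2}$-rational points. For a set $\Omega$ of $N$ points of $\mathrm{PG}(r,q^2)$, $\mathcal{C}(\Omega)$ is the linear code of length $N$ over $\mathbb{F}_{q^2}$ spanned by the rows of an $(r+1)\times N$ matrix whose columns are coordinate vectors of the points of $\Omega$ (one representative per point); it is unique up to monomial equivalence. The weight of a codeword is its Hamming weight. *)

theory Defs
  imports
    "HOL-Library.Poly_Mapping"
    "HOL-Number_Theory.Cong"
    "Jordan_Normal_Form.VS_Connect"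
begin

section \<open>Multivariate polynomials and their homogenization\<close>

text \<open>Exponent vectors are finitely supported functions \<open>nat \<Rightarrow>\<^sub>0 nat\<close>; multiplication of
  \<open>'a mpolynomial\<close> is the convolution product of the library's \<open>Poly_Mapping\<close> theory.\<close>

type_synonym 'a mpolynomial = "(nat \<Rightarrow>\<^sub>0 nat) \<Rightarrow>\<^sub>0 'a"

definition mp_var :: "nat \<Rightarrow> 'a::comm_ring_1 mpolynomial" where
  "mp_var i = Poly_Mapping.single (Poly_Mapping.single i 1) 1"

definition mp_const :: "'a::comm_ring_1 \<Rightarrow> 'a mpolynomial" where
  "mp_const c = Poly_Mapping.single 0 c"

definition monomial_degree :: "(nat \<Rightarrow>\<^sub>0 nat) \<Rightarrow> nat" where
  "monomial_degree m = (\<Sum>i\<in>Poly_Mapping.keys m. Poly_Mapping.lookup m i)"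

definition mp_total_degree :: "'a::comm_ring_1 mpolynomial \<Rightarrow> nat" where
  "mp_total_degree p = Max (insert 0 (monomial_degree ` Poly_Mapping.keys p))"

definition mp_eval :: "'a::comm_ring_1 mpolynomial \<Rightarrow> (nat \<Rightarrow> 'a) \<Rightarrow> 'a" where
  "mp_eval p v =
     (\<Sum>m\<in>Poly_Mapping.keys p. Poly_Mapping.lookup p m *
        (\<Prod>i\<in>Poly_Mapping.keys m. v i ^ Poly_Mapping.lookup m i))"

text \<open>Homogenization with respect to the variable with index 0, which is meant not to occur
  in \<open>p\<close>.\<close>

definition mp_homogenize :: "'a::comm_ring_1 mpolynomial \<Rightarrow> 'a mpolynomial" where
  "mp_homogenize p =
     (\<Sum>m\<in>Poly_Mapping.keys p.
        Poly_Mapping.single (m + Poly_Mapping.single 0 (mp_total_degree p - monomial_degree m))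
          (Poly_Mapping.lookup p m))"

section \<open>Projective space\<close>

text \<open>A point is the set of all its coordinate vectors \<open>(X\<^sub>0, \<dots>, X\<^sub>r)\<close>.\<close>

definition proj_point :: "'a::field vec \<Rightarrow> 'a vec set" where
  "proj_point v = {c \<cdot>\<^sub>v v | c. c \<noteq> 0}"

definition PG :: "nat \<Rightarrow> 'a::field vec set set" where
  "PG r = {proj_point v | v. v \<in> carrier_vec (r + 1) \<and> v \<noteq> 0\<^sub>v (r + 1)}"

text \<open>For a polynomial in the affine coordinates \<open>x\<^sub>1, \<dots>, x\<^sub>r\<close>, the rational points of the
  projective hypersurface it defines.\<close>

definition proj_hypersurface :: "nat \<Rightarrow> 'a::field mpolynomial \<Rightarrow> 'a vec set set" where
  "proj_hypersurface r p =
     {P \<in> PG r. \<forall>v\<in>P. mp_eval (mp_homogenize p) (\<lambda>i. v $ i) = 0}"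

section \<open>The varieties\<close>

text \<open>In a finite field of order \<open>q\<^sup>2\<close>, the copy of \<open>F\<^sub>q\<close> is the fixed field of \<open>x \<mapsto> x\<^sup>q\<close>.\<close>

definition subfield_of_order :: "nat \<Rightarrow> 'a::field set" where
  "subfield_of_order q = {x. x ^ q = x}"

definition absolute_trace :: "nat \<Rightarrow> 'a::field \<Rightarrow> 'a" where
  "absolute_trace e x = (\<Sum>i<e. x ^ (2 ^ i))"

text \<open>\<open>\<Gamma>\<close> is used over the polynomial ring, with \<open>x\<close> a variable and \<open>\<epsilon>\<close> a constant polynomial.
  Here \<open>s\<close> is the number written \<open>\<sigma>\<close> in exponents.\<close>

definition Gamma_eps :: "nat \<Rightarrow> 'b::comm_ring_1 \<Rightarrow> 'b \<Rightarrow> 'b" where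
  "Gamma_eps e \<epsilon> x =
     (let q = 2 ^ e; s = 2 ^ ((e + 1) div 2) in
        (x + (x ^ q + x) * \<epsilon>) ^ (s + 2) + (x ^ q + x) ^ s
        + (x ^ (2 * q) + x\<^sup>2) * \<epsilon> + x ^ (q + 1) + x\<^sup>2)"

definition V_poly :: "nat \<Rightarrow> 'a::field \<Rightarrow> nat \<Rightarrow> 'a mpolynomial" where
  "V_poly e \<epsilon> r =
     mp_var r ^ (2 ^ e) + mp_var r - (\<Sum>i=1..r-1. Gamma_eps e (mp_const \<epsilon>) (mp_var i))"

definition V_eps :: "nat \<Rightarrow> 'a::field \<Rightarrow> nat \<Rightarrow> 'a vec set set" where
  "V_eps e \<epsilon> r = proj_hypersurface r (V_poly e \<epsilon> r)"

section \<open>Codes of point sets\<close>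

definition coordinate_matrix :: "nat \<Rightarrow> 'a::field vec set set \<Rightarrow> 'a mat \<Rightarrow> bool" where
  "coordinate_matrix r \<Omega> A \<longleftrightarrow>
     A \<in> carrier_mat (r + 1) (card \<Omega>) \<and>
     bij_betw (\<lambda>j. proj_point (col A j)) {..<card \<Omega>} \<Omega>"

text \<open>The code of \<open>\<Omega>\<close> is only defined up to monomial equivalence (the choice and order of the
  coordinate vectors), hence a predicate.\<close>

definition is_code_of_points :: "nat \<Rightarrow> 'a::field vec set set \<Rightarrow> 'a vec set \<Rightarrow> bool" where
  "is_code_of_points r \<Omega> C \<longleftrightarrow>
     (\<exists>A. coordinate_matrix r \<Omega> A \<and> C = vec_space.row_space (card \<Omega>) A)"

definition hamming_weight :: "'a::zero vec \<Rightarrow> nat" where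
  "hamming_weight w = card {j. j < dim_vec w \<and> w $ j \<noteq> 0}"

end

theory Submission
  imports Defs "HOL-Computational_Algebra.Polynomial" "HOL-Computational_Algebra.Primes"
begin

text \<open>Write \<open>x = a + b \<epsilon>\<close> with \<open>a, b \<in> F\<^sub>q\<close>. Then \<open>\<Gamma> x = a\<^bsup>\<sigma>+2\<^esup> + a b + b\<^sup>\<sigma>\<close>, the function whose graph is
  the affine part of the Suzuki-Tits ovoid. Adding an \<open>F\<^sub>q\<close>-linear form to it amounts, up to a
  constant, to a translation of the plane by an element of the Suzuki group, and the scaling
  \<open>(a, b) \<mapsto> (l a, l\<^bsup>\<sigma>+1\<^esup> b)\<close> multiplies it by \<open>l\<^bsup>\<sigma>+2\<^esup>\<close>, so each such sum takes one value once and all other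
  values \<open>q + 1\<close> times. Convolving two of these distributions counts the affine points on a plane
  \<open>c\<^sub>0 + c\<^sub>1 x\<^sub>1 + c\<^sub>2 x\<^sub>2 + c\<^sub>3 x\<^sub>3 = 0\<close> with \<open>c\<^sub>3 \<noteq> 0\<close>: there are \<open>q\<^sup>3 + q\<^sup>2 - q\<close> or \<open>q\<^sup>3 - q\<close> of them,
  according to whether the two exceptional values match.

  At infinity the equation is \<open>X\<^sub>1\<^bsup>q(\<sigma>+2)\<^esup> = X\<^sub>2\<^bsup>q(\<sigma>+2)\<^esup>\<close>. Since \<open>e \<equiv> 1 (mod 4)\<close>, the map \<open>x \<mapsto> x\<^bsup>\<sigma>+2\<^esup>\<close> is
  injective on the field of order \<open>q\<^sup>2\<close>, so the points at infinity form the line \<open>X\<^sub>1 = X\<^sub>2\<close>.\<close>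

section \<open>Evaluating homogenizations\<close>

definition mp_monomial :: "(nat \<Rightarrow> 'a::comm_ring_1) \<Rightarrow> (nat \<Rightarrow>\<^sub>0 nat) \<Rightarrow> 'a" where
  "mp_monomial v m = (\<Prod>i\<in>Poly_Mapping.keys m. v i ^ Poly_Mapping.lookup m i)"

text \<open>Indices outside the keys contribute \<open>v i ^ 0 = 1\<close>. A common index set is
  wanted because the keys of a sum of exponent vectors need not be those of the summands.\<close>

lemma mp_monomial_superset:
  assumes "finite A" "Poly_Mapping.keys m \<subseteq> A"
  shows "mp_monomial v m = (\<Prod>i\<in>A. v i ^ Poly_Mapping.lookup m i)"
  unfolding mp_monomial_def using assms
  by (intro prod.mono_neutral_left) (auto simp: in_keys_iff)

lemma mp_monomial_add: "mp_monomial v (m + n) = mp_monomial v m * mp_monomial v n"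
proof -
  let ?A = "Poly_Mapping.keys m \<union> Poly_Mapping.keys n"
  have "Poly_Mapping.keys (m + n) \<subseteq> ?A" by (rule Poly_Mapping.keys_add)
  then show ?thesis
    by (simp add: mp_monomial_superset[of ?A] lookup_add power_add prod.distrib)
qed

lemma mp_monomial_zero [simp]: "mp_monomial v 0 = 1"
  by (simp add: mp_monomial_def)

lemma mp_monomial_single [simp]: "mp_monomial v (Poly_Mapping.single i k) = v i ^ k"
  by (simp add: mp_monomial_def)

lemma monomial_degree_superset:
  assumes "finite A" "Poly_Mapping.keys m \<subseteq> A"
  shows "monomial_degree m = (\<Sum>i\<in>A. Poly_Mapping.lookup m i)"
  unfolding monomial_degree_def using assms
  by (intro sum.mono_neutral_left) (auto simp: in_keys_iff)

lemma monomial_degree_add: "monomial_degree (m + n) = monomial_degree m + monomial_degree n"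
proof -
  let ?A = "Poly_Mapping.keys m \<union> Poly_Mapping.keys n"
  have "Poly_Mapping.keys (m + n) \<subseteq> ?A" by (rule Poly_Mapping.keys_add)
  then show ?thesis
    by (simp add: monomial_degree_superset[of ?A] lookup_add sum.distrib)
qed

lemma monomial_degree_zero [simp]: "monomial_degree 0 = 0"
  by (simp add: monomial_degree_def)

lemma monomial_degree_single [simp]: "monomial_degree (Poly_Mapping.single i k) = k"
  by (simp add: monomial_degree_def)

text \<open>The restriction of \<open>p\<close> to the line through \<open>v\<close>: formally \<open>p (t v)\<close> as a polynomial in \<open>t\<close>,
  so that its coefficients are the values at \<open>v\<close> of the homogeneous components of \<open>p\<close>.\<close>

definition graded_eval :: "(nat \<Rightarrow> 'a::comm_ring_1) \<Rightarrow> 'a mpolynomial \<Rightarrow> 'a poly" where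
  "graded_eval v p =
     (\<Sum>m\<in>Poly_Mapping.keys p. monom (Poly_Mapping.lookup p m * mp_monomial v m) (monomial_degree m))"

lemma graded_eval_superset:
  assumes "finite A" "Poly_Mapping.keys p \<subseteq> A"
  shows "graded_eval v p =
    (\<Sum>m\<in>A. monom (Poly_Mapping.lookup p m * mp_monomial v m) (monomial_degree m))"
  unfolding graded_eval_def using assms
  by (intro sum.mono_neutral_left) (auto simp: in_keys_iff)

lemma graded_eval_add: "graded_eval v (p + q) = graded_eval v p + graded_eval v q"
proof -
  let ?A = "Poly_Mapping.keys p \<union> Poly_Mapping.keys q"
  have "Poly_Mapping.keys (p + q) \<subseteq> ?A" by (rule Poly_Mapping.keys_add)
  then show ?thesis
    by (simp add: graded_eval_superset[of ?A] lookup_add distrib_right sum.distrib flip: add_monom)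
qed

lemma graded_eval_zero [simp]: "graded_eval v 0 = 0"
  by (simp add: graded_eval_def)

lemma graded_eval_single:
  "graded_eval v (Poly_Mapping.single m c) = monom (c * mp_monomial v m) (monomial_degree m)"
  by (simp add: graded_eval_def)

lemma graded_eval_sum: "graded_eval v (\<Sum>i\<in>I. f i) = (\<Sum>i\<in>I. graded_eval v (f i))"
  by (induction I rule: infinite_finite_induct) (simp_all add: graded_eval_add)

lemma graded_eval_diff: "graded_eval v (p - q) = graded_eval v p - graded_eval v q"
  using graded_eval_add[of v "p - q" q] by simp

lemma mpolynomial_eq_sum_single:
  "p = (\<Sum>m\<in>Poly_Mapping.keys p. Poly_Mapping.single m (Poly_Mapping.lookup p m))"
  by (rule poly_mapping_eqI)
    (auto simp: lookup_sum lookup_single when_def in_keys_iff)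

text \<open>Both sides are bilinear, so single monomials suffice; there exponent vectors add, hence
  values multiply and degrees add.\<close>

lemma graded_eval_mult: "graded_eval v (p * q) = graded_eval v p * graded_eval v q"
proof -
  have "p * q = (\<Sum>m\<in>Poly_Mapping.keys p. Poly_Mapping.single m (Poly_Mapping.lookup p m)) *
      (\<Sum>n\<in>Poly_Mapping.keys q. Poly_Mapping.single n (Poly_Mapping.lookup q n))"
    by (simp only: mpolynomial_eq_sum_single[symmetric])
  also have "\<dots> = (\<Sum>m\<in>Poly_Mapping.keys p. \<Sum>n\<in>Poly_Mapping.keys q.
      Poly_Mapping.single (m + n) (Poly_Mapping.lookup p m * Poly_Mapping.lookup q n))"
    by (simp only: sum_product mult_single)
  finally have "graded_eval v (p * q) = (\<Sum>m\<in>Poly_Mapping.keys p. \<Sum>n\<in>Poly_Mapping.keys q.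
      graded_eval v (Poly_Mapping.single (m + n) (Poly_Mapping.lookup p m * Poly_Mapping.lookup q n)))"
    by (simp only: graded_eval_sum)
  also have "\<dots> = graded_eval v p * graded_eval v q"
    unfolding graded_eval_def[of v p] graded_eval_def[of v q] sum_product
    by (intro sum.cong refl)
      (simp add: graded_eval_single mp_monomial_add monomial_degree_add mult_monom mult_ac)
  finally show ?thesis .
qed

lemma graded_eval_var: "graded_eval v (mp_var i) = monom (v i) 1"
  by (simp add: mp_var_def graded_eval_single)

lemma graded_eval_const: "graded_eval v (mp_const c) = [:c:]"
  by (simp add: mp_const_def graded_eval_single monom_0)

lemma graded_eval_one [simp]: "graded_eval v 1 = 1"
  using graded_eval_const[of v 1] by (simp add: mp_const_def one_pCons)

lemma graded_eval_power: "graded_eval v (p ^ n) = graded_eval v p ^ n"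
  by (induction n) (simp_all add: graded_eval_mult)

lemma graded_eval_Gamma_eps:
  "graded_eval v (Gamma_eps e (mp_const \<epsilon>) p) = Gamma_eps e [:\<epsilon>:] (graded_eval v p)"
  by (simp add: Gamma_eps_def Let_def graded_eval_add graded_eval_mult graded_eval_power
      graded_eval_const)

lemma poly_Gamma_eps: "poly (Gamma_eps e [:\<epsilon>:] p) t = Gamma_eps e \<epsilon> (poly p t)"
  by (simp add: Gamma_eps_def Let_def mult.commute)

lemma mp_eval_eq_poly: "mp_eval p v = poly (graded_eval v p) 1"
  by (simp add: mp_eval_def graded_eval_def poly_sum poly_monom mp_monomial_def)

lemma mp_eval_homogenize:
  "mp_eval (mp_homogenize p) v =
    (\<Sum>m\<in>Poly_Mapping.keys p. Poly_Mapping.lookup p m * mp_monomial v m *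
      v 0 ^ (mp_total_degree p - monomial_degree m))"
  by (simp add: mp_eval_eq_poly mp_homogenize_def graded_eval_sum graded_eval_single poly_sum
      poly_monom mp_monomial_add mult.assoc)

lemma monomial_degree_le_total_degree:
  "m \<in> Poly_Mapping.keys p \<Longrightarrow> monomial_degree m \<le> mp_total_degree p"
  by (simp add: mp_total_degree_def)

text \<open>With D the total degree, a term of degree d carries the factor
  \<open>v 0 ^ (D - d)\<close>; taking out \<open>v 0 ^ D\<close> leaves
  \<open>(1 / v 0) ^ d\<close>, that is, the affine polynomial.\<close>

lemma mp_eval_homogenize_affine:
  fixes v :: "nat \<Rightarrow> 'a::field"
  assumes "v 0 \<noteq> 0"
  shows "mp_eval (mp_homogenize p) v =
    v 0 ^ mp_total_degree p * poly (graded_eval v p) (1 / v 0)"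
  unfolding mp_eval_homogenize graded_eval_def poly_sum sum_distrib_left
  using assms
  by (intro sum.cong)
    (auto simp: poly_monom power_diff monomial_degree_le_total_degree field_simps)

text \<open>The factor \<open>0 ^ (D - d)\<close> is 1 for d = D and 0 for smaller d, so only the
  part of top degree survives.\<close>

lemma mp_eval_homogenize_at_infinity:
  assumes "v 0 = 0"
  shows "mp_eval (mp_homogenize p) v = coeff (graded_eval v p) (mp_total_degree p)"
  unfolding mp_eval_homogenize graded_eval_def coeff_sum
  using assms
  by (intro sum.cong)
    (use monomial_degree_le_total_degree[of _ p] in \<open>fastforce simp: power_0_left le_antisym\<close>)+

section \<open>Bounds for the total degree\<close>

lemma mp_total_degree_le_iff:
  "mp_total_degree p \<le> d \<longleftrightarrow> (\<forall>m\<in>Poly_Mapping.keys p. monomial_degree m \<le> d)"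
  by (simp add: mp_total_degree_def)

lemma mp_total_degree_add_le:
  "mp_total_degree p \<le> d \<Longrightarrow> mp_total_degree q \<le> d \<Longrightarrow> mp_total_degree (p + q) \<le> d"
  using Poly_Mapping.keys_add[of p q] by (fastforce simp: mp_total_degree_le_iff)

lemma mp_total_degree_diff_le:
  "mp_total_degree p \<le> d \<Longrightarrow> mp_total_degree q \<le> d \<Longrightarrow> mp_total_degree (p - q) \<le> d"
  using Poly_Mapping.keys_diff[of p q] by (fastforce simp: mp_total_degree_le_iff)

lemma mp_total_degree_sum_le:
  "(\<And>i. i \<in> I \<Longrightarrow> mp_total_degree (f i) \<le> d) \<Longrightarrow> mp_total_degree (\<Sum>i\<in>I. f i) \<le> d"
proof (induction I rule: infinite_finite_induct)
  case (insert x F)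
  then show ?case by (auto intro: mp_total_degree_add_le)
qed (simp_all add: mp_total_degree_le_iff)

lemma mp_total_degree_mult_le:
  assumes "mp_total_degree p \<le> c" "mp_total_degree q \<le> d"
  shows "mp_total_degree (p * q) \<le> c + d"
  using assms Poly_Mapping.keys_mult[of p q]
  by (fastforce simp: mp_total_degree_le_iff monomial_degree_add intro: add_mono)

lemma mp_total_degree_power_le:
  assumes "mp_total_degree p \<le> d"
  shows "mp_total_degree (p ^ n) \<le> d * n"
proof (induction n)
  case (Suc n)
  then show ?case using mp_total_degree_mult_le[OF assms Suc] by simp
qed (simp add: mp_total_degree_def)

lemma mp_total_degree_var_le: "mp_total_degree (mp_var i) \<le> 1"
  by (simp add: mp_var_def mp_total_degree_le_iff)

lemma mp_total_degree_const_le: "mp_total_degree (mp_const c) \<le> 0"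
  by (simp add: mp_const_def mp_total_degree_def)

text \<open>Serves for lower bounds: one \<open>v\<close> at which the component of degree
  \<open>d\<close> does not vanish shows that its monomials have not all cancelled.\<close>

lemma le_mp_total_degree:
  assumes "coeff (graded_eval v p) d \<noteq> 0"
  shows "d \<le> mp_total_degree p"
proof (rule ccontr)
  assume "\<not> d \<le> mp_total_degree p"
  then have "monomial_degree m \<noteq> d" if "m \<in> Poly_Mapping.keys p" for m
    using monomial_degree_le_total_degree[OF that] by auto
  then have "coeff (graded_eval v p) d = 0"
    by (simp add: graded_eval_def coeff_sum)
  with assms show False by contradiction
qed

text \<open>The bracket raised to \<open>s + 2\<close> dominates: its base has degree at most
  \<open>q\<close>, and the other terms stay within \<open>q * (s + 2)\<close>.\<close>

lemma mp_total_degree_Gamma_eps_le: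
  assumes "e \<ge> 1"
  shows "mp_total_degree (Gamma_eps e (mp_const \<epsilon>) (mp_var i)) \<le> 2 ^ e * (2 ^ ((e + 1) div 2) + 2)"
proof -
  define q s :: nat where "q = 2 ^ e" and "s = 2 ^ ((e + 1) div 2)"
  have pow: "mp_total_degree (mp_var i ^ n) \<le> d" if "n \<le> d" for n d
    using order_trans[OF mp_total_degree_power_le[OF mp_total_degree_var_le, of i n]] that by simp
  have const: "mp_total_degree (p * mp_const \<epsilon>) \<le> d" if "mp_total_degree p \<le> d" for p d
    using mp_total_degree_mult_le[OF that mp_total_degree_const_le] by simp
  have "q \<ge> 2 ^ 1" unfolding q_def using assms by (intro power_increasing) auto
  then have q: "2 \<le> q" by simp
  have q1: "1 \<le> q" "q * s \<le> q * (s + 2)" "2 * q \<le> q * (s + 2)" "2 \<le> q * (s + 2)"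
      "q + 1 \<le> q * (s + 2)"
    using q by (simp_all add: algebra_simps)
  have var: "mp_total_degree (mp_var i) \<le> q"
    using mp_total_degree_var_le[of i] q1(1) by (rule order_trans)
  have lin: "mp_total_degree (mp_var i ^ q + mp_var i) \<le> q"
    by (intro mp_total_degree_add_le pow var) simp
  have "mp_total_degree ((mp_var i ^ q + mp_var i) ^ s) \<le> q * (s + 2)"
    using mp_total_degree_power_le[OF lin] q1(2) by (rule order_trans)
  moreover have "mp_total_degree
      ((mp_var i + (mp_var i ^ q + mp_var i) * mp_const \<epsilon>) ^ (s + 2)) \<le> q * (s + 2)"
    by (intro mp_total_degree_power_le mp_total_degree_add_le const lin var)
  ultimately have "mp_total_degree (Gamma_eps e (mp_const \<epsilon>) (mp_var i)) \<le> q * (s + 2)"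
    unfolding Gamma_eps_def Let_def q_def[symmetric] s_def[symmetric]
    by (intro mp_total_degree_add_le const pow q1) auto
  then show ?thesis by (simp only: q_def s_def)
qed

section \<open>Coefficients in the top degree\<close>

lemma coeff_mult_degree_le:
  assumes "degree p \<le> m" "degree q \<le> n"
  shows "coeff (p * q) (m + n) = coeff p m * coeff q n"
proof (cases "degree p = m \<and> degree q = n")
  case True
  then show ?thesis using coeff_mult_degree_sum[of p q] by blast
next
  case False
  \<comment> \<open>If one bound is strict, both sides are 0. Working with bounds thus covers
    vanishing leading coefficients as well.\<close>
  then have "degree p + degree q < m + n" "coeff p m = 0 \<or> coeff q n = 0"
    using assms by (auto intro: coeff_eq_0)
  then show ?thesis
    using degree_mult_le[of p q] by (auto simp: coeff_eq_0)
qed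

lemma coeff_power_degree_le:
  assumes "degree p \<le> m"
  shows "coeff (p ^ n) (m * n) = coeff p m ^ n"
proof (induction n)
  case (Suc n)
  have "degree (p ^ n) \<le> m * n"
    using degree_power_le[of p n] assms by (meson mult_le_mono1 order_trans)
  then show ?case
    using coeff_mult_degree_le[OF assms, of "p ^ n" "m * n"] Suc by simp
qed simp

text \<open>Only the first bracket reaches degree \<open>q * (s + 2)\<close>; its part of degree
  \<open>q\<close> is \<open>c ^ q * \<epsilon>\<close>.\<close>

lemma coeff_Gamma_eps:
  assumes "e \<ge> 1"
  shows "coeff (Gamma_eps e [:\<epsilon>:] (monom c 1)) (2 ^ e * (2 ^ ((e + 1) div 2) + 2)) =
    (c ^ 2 ^ e * \<epsilon>) ^ (2 ^ ((e + 1) div 2) + 2)"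
proof -
  define q s :: nat where "q = 2 ^ e" and "s = 2 ^ ((e + 1) div 2)"
  have "q \<ge> 2 ^ 1" "s \<ge> 2 ^ 1" unfolding q_def s_def using assms by (intro power_increasing; simp)+
  then have q: "2 \<le> q" and s: "2 \<le> s" by simp_all
  let ?M = "monom c 1"
  have lin: "degree (monom (c ^ q) q + ?M) \<le> q"
    using q by (intro degree_add_le degree_monom_le order_trans[OF degree_monom_le]) auto
  have "degree ((monom (c ^ q) q + ?M) ^ s) \<le> q * s"
    using degree_power_le[of "monom (c ^ q) q + ?M" s] lin by (meson mult_le_mono1 order_trans)
  then have "degree ((monom (c ^ q) q + ?M) ^ s) < q * (s + 2)"
    using q by (simp add: algebra_simps)
  then have 1: "coeff ((monom (c ^ q) q + ?M) ^ s) (q * (s + 2)) = 0"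
    by (rule coeff_eq_0)
  have "degree (?M + (monom (c ^ q) q + ?M) * [:\<epsilon>:]) \<le> q"
    using q lin degree_mult_le[of "monom (c ^ q) q + ?M" "[:\<epsilon>:]"]
    by (intro degree_add_le order_trans[OF degree_monom_le]) auto
  then have 2: "coeff ((?M + (monom (c ^ q) q + ?M) * [:\<epsilon>:]) ^ (s + 2)) (q * (s + 2)) =
      (c ^ q * \<epsilon>) ^ (s + 2)"
    using q by (subst coeff_power_degree_le) (auto simp: mult.commute)
  have "2 * q < q * (s + 2)" "2 < q * (s + 2)" "q + 1 < q * (s + 2)"
    using q s mult_le_mono[OF q s] by (simp_all add: algebra_simps)
  then show ?thesis
    unfolding Gamma_eps_def Let_def q_def[symmetric] s_def[symmetric]
    using 1 2 by (simp add: monom_power coeff_monom_mult del: power_add_numeral2 add_2_eq_Suc'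
        distrib_left_numeral mult_Suc_right power_Suc)
qed

section \<open>The Suzuki-Tits function\<close>

lemma finite_field_power_card:
  fixes x :: "'a::{finite,field}"
  shows "x ^ card (UNIV :: 'a set) = x"
proof (cases "x = 0")
  case False
  \<comment> \<open>Multiplication by \<open>x\<close> permutes the nonzero elements, and their
    product cancels.\<close>
  let ?U = "UNIV - {0 :: 'a}"
  have "bij_betw ((*) x) ?U ?U"
    using False by (intro bij_betw_byWitness[where f' = "\<lambda>y. y / x"]) auto
  then have "\<Prod>?U = (\<Prod>y\<in>?U. x * y)"
    by (rule prod.reindex_bij_betw[symmetric])
  also have "\<dots> = x ^ card ?U * \<Prod>?U"
    by (simp only: prod.distrib prod_constant)
  finally have "x ^ card ?U = 1" by simp
  moreover have "card (UNIV :: 'a set) = Suc (card ?U)"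
    using card_Suc_Diff1[of "UNIV :: 'a set" 0] by simp
  ultimately show ?thesis by (simp only: power_Suc mult_1_right)
qed (simp add: finite_UNIV_card_ge_0)

text \<open>Translation by 1 permutes the field, so the sum of all elements is unchanged by adding
  \<open>card UNIV\<close> times 1; hence the prime characteristic divides
  \<open>2 ^ n\<close>.\<close>

lemma CHAR_eq_2:
  assumes "card (UNIV :: 'a::{finite,field} set) = 2 ^ n"
  shows "CHAR('a) = 2"
proof -
  have "prime CHAR('a)"
    using prime_CHAR_semidom[where 'a = 'a] finite_imp_CHAR_pos[where 'a = 'a] by simp
  moreover have "CHAR('a) dvd 2 ^ n"
  proof -
    have "(\<Sum>x\<in>UNIV. x) = (\<Sum>x\<in>UNIV. x + (1 :: 'a))"
      by (rule sum.reindex_bij_betw[symmetric])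
        (rule bij_betw_byWitness[where f' = "\<lambda>x. x - 1"], auto)
    then have "of_nat (card (UNIV :: 'a set)) = (0 :: 'a)" by (simp add: sum.distrib)
    then show ?thesis by (simp only: assms of_nat_eq_0_iff_char_dvd)
  qed
  ultimately show ?thesis
    using prime_dvd_power primes_dvd_imp_eq two_is_prime_nat by blast
qed

lemma card_eq_sum_fibers:
  assumes "finite A" "finite B" "\<And>x. x \<in> A \<Longrightarrow> f x \<in> B"
  shows "card A = (\<Sum>b\<in>B. card {x \<in> A. f x = b})"
  using sum.group[OF assms(1,2), of f "\<lambda>_. 1 :: nat"] assms(3) by fastforce

locale tits_field =
  fixes e q s :: nat and \<epsilon> \<delta> :: "'a::{finite,field}"
  assumes odd_e: "odd e" and q_def: "q = 2 ^ e" and s_def: "s = 2 ^ ((e + 1) div 2)"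
    and card_UNIV: "card (UNIV :: 'a set) = q\<^sup>2"
    and \<epsilon>_notin: "\<epsilon> \<notin> subfield_of_order q" and \<delta>_in: "\<delta> \<in> subfield_of_order q"
    and \<epsilon>_root: "\<epsilon>\<^sup>2 + \<epsilon> + \<delta> = 0"
begin

abbreviation K :: "'a set" where "K \<equiv> subfield_of_order q"

section \<open>Frobenius powers and the subfield of order q\<close>

lemma CHAR: "CHAR('a) = 2"
  using CHAR_eq_2[where 'a = 'a, of "e * 2"] card_UNIV by (simp add: q_def power_mult)

lemma add_self [simp]: "x + x = (0 :: 'a)"
  using uminus_CHAR_2[OF CHAR, of x] by (metis add.right_inverse)

lemma add_self_left [simp]: "x + (x + y) = (y :: 'a)"
  by (simp flip: add.assoc)

lemma diff_eq_add [simp]: "x - y = x + (y :: 'a)"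
  using minus_CHAR_2[OF CHAR] .

lemma add_eq_0_iff_char2: "x + y = 0 \<longleftrightarrow> x = (y :: 'a)"
  by (metis add_self add_self_left add_0_right)

lemma add_eq_iff_char2: "x + y = z \<longleftrightarrow> x = z + (y :: 'a)"
  by (metis add_self_left add.commute)

lemma mult_two [simp]: "2 * x = (0 :: 'a)"
  by (metis mult_2 add_self)

lemma power_add_q: "(x + y) ^ q = x ^ q + (y :: 'a) ^ q"
  by (rule freshmans_dream'[where n = e]) (simp_all add: CHAR q_def)

lemma power_add_s: "(x + y) ^ s = x ^ s + (y :: 'a) ^ s"
  by (rule freshmans_dream'[where n = "(e + 1) div 2"]) (simp_all add: CHAR s_def)

lemma power_add_2: "(x + y)\<^sup>2 = x\<^sup>2 + (y :: 'a)\<^sup>2"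
  by (simp add: power2_sum mult.assoc)

text \<open>Oddness of \<open>e\<close> makes \<open>(e + 1) div 2\<close> exact.\<close>

lemma s_square: "s * s = q * 2"
proof -
  have "(e + 1) div 2 + (e + 1) div 2 = e + 1" using odd_e by presburger
  then show ?thesis by (simp add: s_def q_def flip: power_add)
qed

lemma q_s_pos [simp]: "q > 0" "s > 0" "q \<noteq> 0" "s \<noteq> 0"
  by (simp_all add: q_def s_def)

lemma q_q_power: "(x ^ q) ^ q = (x :: 'a)"
  using finite_field_power_card[of x] by (simp add: card_UNIV power2_eq_square flip: power_mult)

lemma in_K_iff: "x \<in> K \<longleftrightarrow> x ^ q = x"
  by (simp add: subfield_of_order_def)

text \<open>On \<open>K\<close> the \<open>s\<close>-th power is a Tits automorphism: applied twice
  it is the Frobenius map.\<close>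

lemma s_s_power: "x \<in> K \<Longrightarrow> (x ^ s) ^ s = x\<^sup>2"
  unfolding power_mult[symmetric] s_square by (simp add: power_mult in_K_iff)

lemma power_q_commute: "(x ^ n) ^ q = (x ^ q) ^ n"
  for x :: 'a by (simp add: mult.commute flip: power_mult)

lemma K_0 [simp]: "0 \<in> K" and K_1 [simp]: "1 \<in> K"
  by (simp_all add: in_K_iff)

lemma K_add [simp]: "x \<in> K \<Longrightarrow> y \<in> K \<Longrightarrow> x + y \<in> K"
  by (simp add: in_K_iff power_add_q)

lemma K_mult [simp]: "x \<in> K \<Longrightarrow> y \<in> K \<Longrightarrow> x * y \<in> K"
  by (simp add: in_K_iff power_mult_distrib)

lemma K_divide [simp]: "x \<in> K \<Longrightarrow> y \<in> K \<Longrightarrow> x / y \<in> K"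
  by (simp add: in_K_iff power_divide)

lemma K_power [simp]: "x \<in> K \<Longrightarrow> x ^ n \<in> K"
  by (simp add: in_K_iff power_q_commute)

section \<open>The relative trace and coordinates over K\<close>

definition tr :: "'a \<Rightarrow> 'a" where "tr x = x ^ q + x"

lemma tr_in_K [simp]: "tr x \<in> K"
  by (simp add: tr_def in_K_iff power_add_q q_q_power add.commute)

lemma tr_add: "tr (x + y) = tr x + tr y"
  by (simp add: tr_def power_add_q ac_simps)

lemma tr_mult_K: "a \<in> K \<Longrightarrow> tr (x * a) = tr x * a"
  by (simp add: tr_def in_K_iff power_mult_distrib distrib_right)

lemma tr_K: "a \<in> K \<Longrightarrow> tr a = 0"
  by (simp add: tr_def in_K_iff)

text \<open>Adding the quadratic equation of \<epsilon> to its conjugate gives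
  \<open>tr \<epsilon> * (tr \<epsilon> + 1) = 0\<close>, and trace 0 would put \<epsilon> into
  \<open>K\<close>.\<close>

lemma tr_\<epsilon> [simp]: "tr \<epsilon> = 1"
proof -
  have "tr \<epsilon> * (tr \<epsilon> + 1) = (\<epsilon>\<^sup>2 + \<epsilon> + \<delta>) ^ q + (\<epsilon>\<^sup>2 + \<epsilon> + \<delta>)"
    using \<delta>_in unfolding in_K_iff power_add_q power_q_commute
    by (simp add: tr_def power_add_q algebra_simps power2_eq_square)
  also have "\<dots> = 0" by (simp add: \<epsilon>_root power_0_left)
  finally have "tr \<epsilon> = 0 \<or> tr \<epsilon> = 1" by (simp add: add_eq_0_iff_char2)
  moreover have "tr \<epsilon> \<noteq> 0" using \<epsilon>_notin by (simp add: tr_def in_K_iff add_eq_0_iff_char2)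
  ultimately show ?thesis by simp
qed

lemma \<epsilon>_conj: "\<epsilon> ^ q = \<epsilon> + 1"
  using tr_\<epsilon> unfolding tr_def add_eq_iff_char2 by (simp add: add.commute)

lemma add_tr_in_K: "x + tr x * \<epsilon> \<in> K"
  using tr_in_K[of x]
  by (auto simp: in_K_iff power_add_q power_mult_distrib \<epsilon>_conj tr_def distrib_left algebra_simps)

text \<open>Since \<open>tr \<epsilon> = 1\<close>, the trace of \<open>a + b * \<epsilon>\<close>
  reads off \<open>b\<close>, which yields an explicit inverse.\<close>

lemma coordinates: "bij_betw (\<lambda>(a, b). a + b * \<epsilon>) (K \<times> K) UNIV"
proof (rule bij_betw_byWitness[where f' = "\<lambda>x. (x + tr x * \<epsilon>, tr x)"])
  have tr: "tr (a + b * \<epsilon>) = b" if "a \<in> K" "b \<in> K" for a b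
    using that tr_mult_K[of b \<epsilon>] by (simp add: tr_add tr_K mult.commute)
  show "\<forall>p\<in>K \<times> K. (\<lambda>x. (x + tr x * \<epsilon>, tr x)) (case p of (a, b) \<Rightarrow> a + b * \<epsilon>) = p"
    by (auto simp: tr add.assoc)
  show "(\<lambda>x. (x + tr x * \<epsilon>, tr x)) ` UNIV \<subseteq> K \<times> K"
    using add_tr_in_K by auto
qed (auto simp: add.assoc)

lemma coordinatesE:
  obtains a b where "a \<in> K" "b \<in> K" "x = a + b * \<epsilon>"
proof -
  obtain p where "p \<in> K \<times> K" "x = (\<lambda>(a, b). a + b * \<epsilon>) p"
    using coordinates unfolding bij_betw_def by blast
  then show ?thesis using that by auto
qed

lemma card_K: "card K = q"
proof -
  have "card K * card K = q * q"
    using bij_betw_same_card[OF coordinates]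
    by (simp add: card_UNIV card_cartesian_product power2_eq_square)
  then show ?thesis
    by (metis power2_eq_square power2_eq_iff_nonneg zero_le)
qed

text \<open>The fibre is the coset through \<open>k * \<epsilon>\<close> of \<open>K\<close>, the
  kernel of the trace.\<close>

lemma card_tr_fiber:
  assumes k: "k \<in> K"
  shows "card {x. tr x = k} = q"
proof -
  have "bij_betw (\<lambda>a. a + k * \<epsilon>) K {x. tr x = k}"
  proof (rule bij_betw_byWitness[where f' = "\<lambda>x. x + k * \<epsilon>"])
    show "(\<lambda>a. a + k * \<epsilon>) ` K \<subseteq> {x. tr x = k}"
      using k tr_mult_K[of k \<epsilon>] by (auto simp: tr_add tr_K mult.commute)
    show "(\<lambda>x. x + k * \<epsilon>) ` {x. tr x = k} \<subseteq> K"
      using add_tr_in_K by auto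
  qed (auto simp: add.assoc)
  then show ?thesis using bij_betw_same_card card_K by fastforce
qed

section \<open>The Tits function and its fibres\<close>

definition tits :: "'a \<Rightarrow> 'a \<Rightarrow> 'a" where
  "tits a b = a ^ (s + 2) + a * b + b ^ s"

lemma tits_in_K [simp]: "a \<in> K \<Longrightarrow> b \<in> K \<Longrightarrow> tits a b \<in> K"
  by (simp add: tits_def)

text \<open>For \<open>x = a + b * \<epsilon>\<close> the bracket is \<open>a\<close> and
  \<open>x ^ q = x + b\<close>, so the last three terms of \<open>Gamma_eps\<close> become
  \<open>b\<^sup>2 * \<epsilon> + b * x = a * b\<close>.\<close>

lemma Gamma_eps_eq_tits:
  assumes "a \<in> K" "b \<in> K"
  shows "Gamma_eps e \<epsilon> (a + b * \<epsilon>) = tits a b"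
proof -
  let ?x = "a + b * \<epsilon>"
  have tr: "?x ^ q + ?x = b"
    using assms tr_mult_K[of b \<epsilon>] by (simp add: tr_add tr_K mult.commute flip: tr_def)
  then have xq: "?x ^ q = a + b * \<epsilon> + b"
    unfolding add_eq_iff_char2 by (simp add: ac_simps)
  have "Gamma_eps e \<epsilon> ?x =
      (?x + (?x ^ q + ?x) * \<epsilon>) ^ (s + 2) + (?x ^ q + ?x) ^ s + (?x ^ q + ?x)\<^sup>2 * \<epsilon> + ?x ^ q * ?x + ?x\<^sup>2"
    unfolding Gamma_eps_def Let_def s_def[symmetric] q_def[symmetric] power_add_2
    by (simp add: power_add power_mult mult.commute[of 2 q])
  also have "\<dots> = a ^ (s + 2) + b ^ s + b\<^sup>2 * \<epsilon> + (a + b * \<epsilon> + b) * ?x + ?x\<^sup>2"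
    unfolding tr by (simp add: xq add.assoc)
  also have "\<dots> = a ^ (s + 2) + b ^ s + a * b + (b\<^sup>2 * \<epsilon> + b * b * \<epsilon>)"
    by (simp only: power2_eq_square distrib_left distrib_right add_ac mult_ac add_self_left add_self add_0_right add_0_left)
  finally show ?thesis by (simp add: tits_def power2_eq_square add_ac)
qed

lemma Gamma_in_K [simp]: "Gamma_eps e \<epsilon> x \<in> K"
proof -
  obtain a b where "a \<in> K" "b \<in> K" "x = a + b * \<epsilon>"
    by (rule coordinatesE)
  then show ?thesis by (simp add: Gamma_eps_eq_tits)
qed

text \<open>The weight \<open>s + 1\<close> on \<open>b\<close> makes all three terms scale alike,
  because \<open>(l ^ s) ^ s = l\<^sup>2\<close> on \<open>K\<close>.\<close>

lemma tits_scale: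
  assumes "l \<in> K"
  shows "tits (l * a) (l ^ (s + 1) * b) = l ^ (s + 2) * tits a b"
proof -
  have "(l ^ (s + 1)) ^ s = l ^ (s + 2)"
    using s_s_power[OF assms] by (simp add: power_mult_distrib power_add power2_eq_square mult.commute)
  then show ?thesis
    by (simp add: tits_def power_mult_distrib distrib_left)
qed

text \<open>If \<open>a\<close> is nonzero, scale it to 1. Then \<open>z ^ s = z + 1\<close>, and
  applying the \<open>s\<close>-th power again gives \<open>z\<^sup>2 = z\<close>; but neither 0 nor
  1 satisfies the first equation.\<close>

lemma tits_eq_0_iff:
  assumes "a \<in> K" "b \<in> K"
  shows "tits a b = 0 \<longleftrightarrow> a = 0 \<and> b = 0"
proof
  assume zero: "tits a b = 0"
  show "a = 0 \<and> b = 0"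
  proof (cases "a = 0")
    case True
    then show ?thesis using zero by (simp add: tits_def power_0_left)
  next
    case False
    define z where "z = b / a ^ (s + 1)"
    have z: "z \<in> K" using assms by (simp add: z_def)
    have "a ^ (s + 2) * tits 1 z = 0"
      using tits_scale[of a 1 z] assms zero False by (simp add: z_def)
    then have zs: "z ^ s = z + 1"
      using False by (simp add: tits_def add_eq_0_iff_char2 add.commute)
    have "z\<^sup>2 = (z + 1) ^ s" using s_s_power[OF z] by (simp add: zs)
    also have "\<dots> = z" by (simp add: power_add_s zs add.assoc)
    finally have "z = 0 \<or> z = 1" by (simp add: power2_eq_square)
    then show ?thesis using zs by (auto simp: power_0_left)
  qed
qed (simp add: tits_def power_0_left)

definition fiber :: "'a \<Rightarrow> ('a \<times> 'a) set" where
  "fiber u = {p \<in> K \<times> K. tits (fst p) (snd p) = u}"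

lemma fiber_0: "fiber 0 = {(0, 0)}"
  by (auto simp: fiber_def tits_eq_0_iff)

text \<open>The scaling factor is the solution of \<open>l\<^bsup>s+2\<^esup> = u\<close>, which exists because
  \<open>(s + 2)(s - 2) = -2\<close> in the exponent.\<close>

lemma card_fiber_eq:
  assumes u: "u \<in> K" "u \<noteq> 0"
  shows "card (fiber u) = card (fiber 1)"
proof -
  \<comment> \<open>As \<open>h\<close> is half of \<open>s\<close>, \<open>h * s = q\<close>, so
    \<open>u ^ h\<close> is the \<open>s\<close>-th root of \<open>u\<close> in \<open>K\<close>,
    and its square is \<open>u ^ s\<close>.\<close>
  define h :: nat where "h = 2 ^ ((e - 1) div 2)"
  have "(e + 1) div 2 = Suc ((e - 1) div 2)" using odd_e by presburger
  then have s: "s = h * 2" by (simp add: s_def h_def)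
  have "h * s = q" using s_square unfolding s by simp
  then have us: "(u ^ h) ^ s = u" using u by (simp add: in_K_iff flip: power_mult)
  define l where "l = u / u ^ h"
  have l: "l \<in> K" "l \<noteq> 0" using u by (simp_all add: l_def)
  have "l ^ (s + 2) = (u ^ s / (u ^ h) ^ s) * (u\<^sup>2 / (u ^ h)\<^sup>2)"
    by (simp only: power_add l_def power_divide)
  also have "\<dots> = u"
    unfolding us using u(2) by (simp add: s power_mult power2_eq_square)
  finally have lu: "l ^ (s + 2) = u" .
  have "bij_betw (\<lambda>(a, b). (l * a, l ^ (s + 1) * b)) (fiber 1) (fiber u)"
  proof (rule bij_betw_byWitness[where f' = "\<lambda>(a, b). (a / l, b / l ^ (s + 1))"])
    show "(\<lambda>(a, b). (l * a, l ^ (s + 1) * b)) ` fiber 1 \<subseteq> fiber u"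
      using l lu tits_scale[OF l(1)] by (auto simp: fiber_def simp del: power_Suc power_add)
    have "tits (a / l) (b / l ^ (s + 1)) = 1" if "tits a b = u" for a b
      using tits_scale[OF l(1), of "a / l" "b / l ^ (s + 1)"] l that lu u by simp
    then show "(\<lambda>(a, b). (a / l, b / l ^ (s + 1))) ` fiber u \<subseteq> fiber 1"
      using l by (auto simp: fiber_def)
  qed (use l in auto)
  then show ?thesis using bij_betw_same_card by fastforce
qed

text \<open>The \<open>q\<^sup>2\<close> pairs split into the single zero and \<open>q - 1\<close>
  fibres of equal size.\<close>

lemma card_fiber:
  assumes "u \<in> K"
  shows "card (fiber u) = (if u = 0 then 1 else q + 1)"
proof (cases "u = 0")
  case False
  have "q * q = card (K \<times> K)" by (simp add: card_cartesian_product card_K)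
  also have "\<dots> = (\<Sum>v\<in>K. card (fiber v))"
    unfolding fiber_def by (rule card_eq_sum_fibers) auto
  also have "\<dots> = card (fiber 0) + (\<Sum>v\<in>K - {0}. card (fiber v))"
    by (rule sum.remove) simp_all
  also have "(\<Sum>v\<in>K - {0}. card (fiber v)) = (\<Sum>v\<in>K - {0}. card (fiber 1))"
    by (intro sum.cong refl card_fiber_eq) auto
  also have "\<dots> = (q - 1) * card (fiber 1)" by (simp add: card_K)
  finally have eq: "q * q = 1 + (q - 1) * card (fiber 1)" by (simp add: fiber_0)
  have "q \<ge> 2 ^ 1" unfolding q_def using odd_e by (intro power_increasing) (auto elim: oddE)
  then obtain k where k: "q = Suc (Suc k)" using le_iff_add[of 2 q] by auto
  have "(q - 1) * (q + 1) = (q - 1) * card (fiber 1)"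
    using eq by (simp add: k)
  moreover have "q - 1 \<noteq> 0" using k by simp
  ultimately have "card (fiber 1) = q + 1" by (metis mult_left_cancel)
  then show ?thesis using False by (simp add: card_fiber_eq[OF assms False])
qed (simp add: fiber_0)

text \<open>The shear \<open>u ^ s * a\<close> cancels the cross terms of
  \<open>(a + u) ^ (s + 2)\<close>: \<open>u ^ s * a\<^sup>2\<close> through the product,
  \<open>u\<^sup>2 * a ^ s\<close> through the \<open>s\<close>-th power. What remains is linear in
  \<open>a\<close> and \<open>b\<close>.\<close>

lemma tits_translate:
  assumes "u \<in> K"
  shows "tits (a + u) (b + v + u ^ s * a) = tits a b + tits u v + u * b + (v + u ^ (s + 1)) * a"
proof -
  have "(b + v + u ^ s * a) ^ s = b ^ s + v ^ s + u * u * a ^ s"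
    using s_s_power[OF assms] by (simp add: power_add_s power_mult_distrib power2_eq_square)
  moreover have "(a + u) ^ (s + 2) = (a ^ s + u ^ s) * (a * a + u * u)"
    by (simp only: power_add power_add_s power_add_2) (simp add: power2_eq_square)
  ultimately show ?thesis
    by (simp only: tits_def power_add power2_eq_square power_one_right distrib_left distrib_right
        add_ac mult_ac add_self_left add_self add_0_right add_0_left)
qed

lemma Gamma_plus_linear_fibers:
  "\<exists>u0\<in>K. \<forall>u\<in>K. card {x. Gamma_eps e \<epsilon> x + tr (c * x) = u} = (if u = u0 then 1 else q + 1)"
proof -
  \<comment> \<open>Chosen so that the linear part in \<open>tits_translate\<close> has the
    coefficients of \<open>tr (c * x)\<close>: \<open>tr (c * \<epsilon>)\<close> at
    \<open>b\<close> and \<open>tr c\<close> at \<open>a\<close>.\<close>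
  define u where "u = tr (c * \<epsilon>)"
  define v where "v = tr c + u ^ (s + 1)"
  have uv: "u \<in> K" "v \<in> K" by (simp_all add: u_def v_def)
  have vu: "v + u ^ (s + 1) = tr c" by (simp add: v_def add.assoc)
  have shift: "Gamma_eps e \<epsilon> (a + b * \<epsilon>) + tr (c * (a + b * \<epsilon>)) =
      tits (a + u) (b + v + u ^ s * a) + tits u v" if "a \<in> K" "b \<in> K" for a b
  proof -
    have "tr (c * (a + b * \<epsilon>)) = tr (c * a + (c * \<epsilon>) * b)" by (simp add: algebra_simps)
    also have "\<dots> = tr c * a + u * b" using that by (simp add: tr_add tr_mult_K u_def)
    finally show ?thesis
      using that uv unfolding tits_translate[OF uv(1)] vu
      by (simp add: Gamma_eps_eq_tits add_ac)
  qed
  have "card {x. Gamma_eps e \<epsilon> x + tr (c * x) = w} = card (fiber (w + tits u v))" if "w \<in> K" for w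
  proof -
    let ?f = "\<lambda>(a, b). (a + u, b + v + u ^ s * a)"
    let ?A = "{p \<in> K \<times> K. ?f p \<in> fiber (w + tits u v)}"
    \<comment> \<open>The inverse undoes the shear with the original first coordinate, recovered as
      \<open>a + u\<close>.\<close>
    have f: "bij_betw ?f (K \<times> K) (K \<times> K)"
      using uv by (intro bij_betw_byWitness[where f' = "\<lambda>(a, b). (a + u, b + v + u ^ s * (a + u))"])
        (auto simp: algebra_simps)
    have "?f ` ?A = ?f ` (K \<times> K) \<inter> fiber (w + tits u v)" by blast
    also have "?f ` (K \<times> K) = K \<times> K" using f by (simp only: bij_betw_def)
    also have "K \<times> K \<inter> fiber (w + tits u v) = fiber (w + tits u v)" by (auto simp: fiber_def)
    finally have "?f ` ?A = fiber (w + tits u v)" .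
    moreover have "card (?f ` ?A) = card ?A"
      by (intro card_image inj_on_subset[OF bij_betw_imp_inj_on[OF f]]) blast
    ultimately have 1: "card ?A = card (fiber (w + tits u v))" by (simp only:)
    have "(\<lambda>(a, b). a + b * \<epsilon>) ` ?A = {x. Gamma_eps e \<epsilon> x + tr (c * x) = w}"
    proof (intro equalityI subsetI)
      fix x assume x: "x \<in> {x. Gamma_eps e \<epsilon> x + tr (c * x) = w}"
      obtain a b where ab: "a \<in> K" "b \<in> K" "x = a + b * \<epsilon>" by (rule coordinatesE)
      then have "(a, b) \<in> ?A"
        using x uv shift[OF ab(1,2)] by (auto simp: fiber_def add_eq_iff_char2)
      then show "x \<in> (\<lambda>(a, b). a + b * \<epsilon>) ` ?A" using ab by force
    qed (auto simp: shift fiber_def add.assoc)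
    moreover have "card ((\<lambda>(a, b). a + b * \<epsilon>) ` ?A) = card ?A"
      by (intro card_image inj_on_subset[OF bij_betw_imp_inj_on[OF coordinates]]) blast
    ultimately show ?thesis using 1 by (simp only:)
  qed
  \<comment> \<open>The value taken once is \<open>tits u v\<close>, where the translated
    \<open>tits\<close> vanishes.\<close>
  then show ?thesis
    using uv by (intro bexI[of _ "tits u v"]) (auto simp: card_fiber add_eq_0_iff_char2)
qed

text \<open>Split by the value \<open>u\<close> of the first summand; the second must be
  \<open>u + k\<close>. Fibre sizes multiply, and the total depends only on whether
  \<open>u0\<close> equals \<open>w0\<close>.\<close>

lemma card_Gamma_sum_fiber:
  assumes k: "k \<in> K"
  shows "int (card {(x, y). Gamma_eps e \<epsilon> x + tr (c * x) + (Gamma_eps e \<epsilon> y + tr (d * y)) = k}) \<in>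
    {int q ^ 3 - int q, int q ^ 3 + int q ^ 2 - int q}"
proof -
  let ?g = "\<lambda>c x. Gamma_eps e \<epsilon> x + tr (c * x)"
  obtain u0 where u0: "u0 \<in> K" "\<And>u. u \<in> K \<Longrightarrow> card {x. ?g c x = u} = (if u = u0 then 1 else q + 1)"
    using Gamma_plus_linear_fibers[of c] by blast
  obtain v0 where v0: "v0 \<in> K" "\<And>u. u \<in> K \<Longrightarrow> card {x. ?g d x = u} = (if u = v0 then 1 else q + 1)"
    using Gamma_plus_linear_fibers[of d] by blast
  define w0 where "w0 = v0 + k"
  have shift: "u + k = v0 \<longleftrightarrow> u = w0" for u unfolding w0_def by (rule add_eq_iff_char2)
  have w0: "w0 \<in> K" using v0 k by (simp add: w0_def)
  have "card {(x, y). ?g c x + ?g d y = k} =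
      (\<Sum>u\<in>K. card {p \<in> {(x, y). ?g c x + ?g d y = k}. ?g c (fst p) = u})"
    by (rule card_eq_sum_fibers) auto
  also have "\<dots> = (\<Sum>u\<in>K. card ({x. ?g c x = u} \<times> {y. ?g d y = u + k}))"
    by (intro sum.cong refl arg_cong[where f = card]) (auto simp: add_eq_iff_char2 ac_simps)
  also have "\<dots> = (\<Sum>u\<in>K. (if u = u0 then 1 else q + 1) * (if u = w0 then 1 else q + 1))"
    using k by (intro sum.cong refl) (simp add: card_cartesian_product u0(2) v0(2) shift)
  finally have "int (card {(x, y). ?g c x + ?g d y = k}) =
      (\<Sum>u\<in>K. (if u = u0 then 1 else int q + 1) * (if u = w0 then 1 else int q + 1))"
    by (simp only: of_nat_sum) (intro sum.cong refl, auto simp: algebra_simps)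
  \<comment> \<open>Inclusion-exclusion: each exceptional factor lowers the generic square of
    \<open>q + 1\<close> by \<open>q * (q + 1)\<close>, and a coincidence of both restores
    \<open>q\<^sup>2\<close>.\<close>
  also have "\<dots> = (\<Sum>u\<in>K. (int q + 1)\<^sup>2 - (if u = u0 then int q * (int q + 1) else 0)
      - (if u = w0 then int q * (int q + 1) else 0)
      + (if u = u0 then if u0 = w0 then (int q)\<^sup>2 else 0 else 0))"
    by (intro sum.cong refl) (auto simp: power2_eq_square algebra_simps)
  also have "\<dots> = int q * (int q + 1)\<^sup>2 - 2 * int q * (int q + 1) + (if u0 = w0 then (int q)\<^sup>2 else 0)"
    using u0(1) w0 by (simp add: sum.distrib sum_subtractf card_K)
  finally show ?thesis
    by (auto simp: power2_eq_square power3_eq_cube algebra_simps)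
qed

text \<open>The quotient \<open>l\<close> satisfies \<open>l ^ (s + 2) = 1\<close>. Taking powers of
  this relation forces \<open>l ^ 3 = 1\<close>, while the congruence on \<open>e\<close> makes
  \<open>s + 2\<close> congruent to 1 modulo 3.\<close>

lemma power_s_add_2_inj:
  assumes "[e = 1] (mod 4)" and eq: "x ^ (s + 2) = (y :: 'a) ^ (s + 2)"
  shows "x = y"
proof (cases "y = 0")
  case True
  then show ?thesis using eq by simp
next
  case False
  define l where "l = x / y"
  have "l ^ s * l\<^sup>2 = x ^ (s + 2) / y ^ (s + 2)"
    by (simp only: l_def power_divide power_add times_divide_times_eq)
  also have "\<dots> = 1" unfolding eq using False by simp
  finally have l2: "l ^ s * l\<^sup>2 = 1" .
  then have l0: "l \<noteq> 0" by (auto simp: power_0_left)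
  have "(l ^ s) ^ s * (l ^ s)\<^sup>2 = 1"
    using arg_cong[OF l2, of "\<lambda>t. t ^ s"]
    by (simp add: power_mult_distrib power_q_commute mult.commute flip: power_mult)
  moreover have "(l ^ s)\<^sup>2 * (l\<^sup>2)\<^sup>2 = 1"
    using arg_cong[OF l2, of "\<lambda>t. t\<^sup>2"] by (simp only: power_mult_distrib power_one)
  \<comment> \<open>Both sides are inverse to \<open>(l ^ s)\<^sup>2\<close>.\<close>
  ultimately have "(l ^ s) ^ s = (l\<^sup>2)\<^sup>2"
    using l0 by (metis mult.commute mult_right_cancel power_not_zero)
  moreover have "(l ^ q)\<^sup>2 = (l ^ s) ^ s" by (simp only: power_mult[symmetric] s_square)
  ultimately have "(l ^ q)\<^sup>2 = (l\<^sup>2)\<^sup>2" by (simp only:)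
  \<comment> \<open>Squaring is additive in characteristic 2, hence injective.\<close>
  then have "(l ^ q + l\<^sup>2)\<^sup>2 = 0" by (simp only: power_add_2 add_self)
  then have lq: "l ^ q = l\<^sup>2" by (simp add: add_eq_0_iff_char2)
  have "l = (l\<^sup>2) ^ q" using q_q_power[of l] by (simp add: lq)
  also have "\<dots> = (l\<^sup>2)\<^sup>2" by (simp only: power_q_commute lq)
  also have "\<dots> = l * l ^ 3" by (simp add: power2_eq_square power3_eq_cube)
  finally have l3: "l ^ 3 = 1" using l0 by simp
  define k where "k = e div 4"
  have k: "e = 4 * k + 1"
    using assms(1) div_mult_mod_eq[of e 4] by (simp add: k_def cong_def)
  \<comment> \<open>Since \<open>s = 2 * 4 ^ k\<close>, this shows that \<open>s\<close> is 2 modulo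
    3.\<close>
  have "[4 ^ k = 1 ^ k] (mod 3 :: nat)" by (intro cong_pow) (simp add: cong_def)
  then have "4 ^ k = 3 * (4 ^ k div 3) + (1 :: nat)"
    using div_mult_mod_eq[of "4 ^ k :: nat" 3] by (simp add: cong_def)
  then obtain n :: nat where "4 ^ k = 3 * n + (1 :: nat)" ..
  moreover have "s = 2 * 4 ^ k" by (simp add: s_def k power_mult)
  ultimately have "s = 3 * (2 * n) + 2" by simp
  then have "l ^ s = l\<^sup>2" by (simp only: power_add power_mult l3 power_one mult_1_left)
  then have "l ^ 3 * l = 1" using l2 by (simp add: power2_eq_square power3_eq_cube mult_ac)
  then have "l = 1" by (simp add: l3)
  then show ?thesis using False by (simp add: l_def)
qed

end

section \<open>Points and plane sections\<close>

lemma proj_point_eq_iff: "proj_point u = proj_point v \<longleftrightarrow> (\<exists>c. c \<noteq> 0 \<and> u = c \<cdot>\<^sub>v v)"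
proof
  assume "proj_point u = proj_point v"
  moreover have "u \<in> proj_point u"
    unfolding proj_point_def by (rule CollectI, rule exI[of _ 1]) simp
  ultimately show "\<exists>c. c \<noteq> 0 \<and> u = c \<cdot>\<^sub>v v" by (auto simp: proj_point_def)
next
  assume "\<exists>c. c \<noteq> 0 \<and> u = c \<cdot>\<^sub>v v"
  then obtain c where c: "c \<noteq> 0" "u = c \<cdot>\<^sub>v v" by blast
  show "proj_point u = proj_point v"
  proof (intro equalityI subsetI)
    fix x assume "x \<in> proj_point u"
    then obtain d where "d \<noteq> 0" "x = d \<cdot>\<^sub>v u" by (auto simp: proj_point_def)
    then have "d * c \<noteq> 0" "x = (d * c) \<cdot>\<^sub>v v" using c by (simp_all add: smult_smult_assoc)
    then show "x \<in> proj_point v" unfolding proj_point_def by blast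
  next
    fix x assume "x \<in> proj_point v"
    then obtain d where "d \<noteq> 0" "x = d \<cdot>\<^sub>v v" by (auto simp: proj_point_def)
    then have "d / c \<noteq> 0" "x = (d / c) \<cdot>\<^sub>v u" using c by (simp_all add: smult_smult_assoc)
    then show "x \<in> proj_point u" unfolding proj_point_def by blast
  qed
qed

section \<open>Codeword weights as point counts\<close>

lemma hamming_weight_eq_0_iff: "hamming_weight w = 0 \<longleftrightarrow> w = 0\<^sub>v (dim_vec w)"
proof -
  have "finite {j. j < dim_vec w \<and> w $ j \<noteq> 0}" by simp
  then show ?thesis unfolding hamming_weight_def by (auto simp: vec_eq_iff)
qed

text \<open>A codeword is a linear form evaluated at the columns of the matrix. Rescaling a column
  does not affect whether its entry vanishes, so any system of representatives gives the same
  count.\<close>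

lemma hamming_weight_code_of_points:
  assumes "is_code_of_points r \<Omega> C" and "w \<in> C"
    and R: "bij_betw proj_point R \<Omega>" "R \<subseteq> carrier_vec (r + 1)"
  obtains c where "c \<in> carrier_vec (r + 1)"
    and "hamming_weight w = card {u \<in> R. c \<bullet> u \<noteq> 0}"
proof -
  let ?N = "card \<Omega>"
  obtain A where A: "A \<in> carrier_mat (r + 1) ?N"
    and bij: "bij_betw (\<lambda>j. proj_point (col A j)) {..<?N} \<Omega>"
    and C: "C = vec_space.row_space ?N A"
    using assms(1) unfolding is_code_of_points_def coordinate_matrix_def by blast
  obtain y where y: "y \<in> carrier_vec (r + 1)" and w: "A\<^sup>T *\<^sub>v y = w"
    using \<open>w \<in> C\<close> A unfolding C vec_space.row_space_eq[OF A] by auto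
  define h where "h = inv_into R proj_point \<circ> (\<lambda>j. proj_point (col A j))"
  have h: "bij_betw h {..<?N} R"
    unfolding h_def by (rule bij_betw_trans[OF bij bij_betw_inv_into[OF R(1)]])
  have nz: "w $ j = 0 \<longleftrightarrow> y \<bullet> h j = 0" if j: "j < ?N" for j
  proof -
    have "h j \<in> R" using h j by (auto simp: bij_betw_def)
    then have hj: "h j \<in> carrier_vec (r + 1)" using R by blast
    have "proj_point (col A j) \<in> proj_point ` R"
      using bij R(1) j by (auto simp: bij_betw_def)
    then have "proj_point (col A j) = proj_point (h j)"
      unfolding h_def comp_def by (rule f_inv_into_f[symmetric])
    then obtain c where c: "c \<noteq> 0" "col A j = c \<cdot>\<^sub>v h j" unfolding proj_point_eq_iff by blast
    have "w $ j = col A j \<bullet> y" using A j by (simp add: w[symmetric])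
    also have "\<dots> = c * (y \<bullet> h j)"
      using hj y by (simp add: c comm_scalar_prod[OF y hj])
    finally show ?thesis using c by simp
  qed
  have "dim_vec w = ?N" using A w by auto
  then have "hamming_weight w = card {j \<in> {..<?N}. y \<bullet> h j \<noteq> 0}"
    unfolding hamming_weight_def by (intro arg_cong[where f = card]) (auto simp: nz)
  also have "\<dots> = card (h ` {j \<in> {..<?N}. y \<bullet> h j \<noteq> 0})"
    using h by (intro card_image[symmetric]) (auto simp: bij_betw_def intro: inj_on_subset)
  also have "h ` {j \<in> {..<?N}. y \<bullet> h j \<noteq> 0} = {u \<in> h ` {..<?N}. y \<bullet> u \<noteq> 0}" by blast
  also have "h ` {..<?N} = R" using h by (simp add: bij_betw_def)
  finally show ?thesis using y that by blast
qed

lemma carrier_vec4_eq_iff: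
  "u \<in> carrier_vec 4 \<Longrightarrow> v \<in> carrier_vec 4 \<Longrightarrow>
    u = v \<longleftrightarrow> u $ 0 = v $ 0 \<and> u $ 1 = v $ 1 \<and> u $ 2 = v $ 2 \<and> u $ 3 = v $ 3"
  by (auto simp: vec_eq_iff numeral_eq_Suc less_Suc_eq)

definition vec4 :: "'a \<Rightarrow> 'a \<Rightarrow> 'a \<Rightarrow> 'a \<Rightarrow> 'a vec" where
  "vec4 a b c d = vec_of_list [a, b, c, d]"

lemma vec4_carrier [simp]: "vec4 a b c d \<in> carrier_vec 4"
  unfolding vec4_def by (intro carrier_vecI) simp

lemma dim_vec4 [simp]: "dim_vec (vec4 a b c d) = 4"
  using vec4_carrier by (rule carrier_vecD)

lemma vec4_index [simp]:
  "vec4 a b c d $ 0 = a" "vec4 a b c d $ 1 = b" "vec4 a b c d $ Suc 0 = b"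
  "vec4 a b c d $ 2 = c" "vec4 a b c d $ 3 = d"
  unfolding vec4_def by (simp_all only: vec_of_list_index) (simp_all add: numeral_eq_Suc)

lemma vec4_eq_iff [simp]:
  "vec4 a b c d = vec4 a' b' c' d' \<longleftrightarrow> a = a' \<and> b = b' \<and> c = c' \<and> d = d'"
  by (simp add: carrier_vec4_eq_iff)

lemma scalar_prod_vec4:
  "c \<in> carrier_vec 4 \<Longrightarrow>
    c \<bullet> vec4 x0 x1 x2 x3 = c $ 0 * x0 + c $ 1 * x1 + c $ 2 * x2 + c $ 3 * x3"
proof -
  have "{0..<4} = {0, 1, 2, 3 :: nat}" by auto
  then show ?thesis by (simp add: scalar_prod_def add.assoc)
qed

section \<open>The equation of the variety in the affine chart and at infinity\<close>

context tits_field
begin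

abbreviation \<Gamma> :: "'a \<Rightarrow> 'a" where "\<Gamma> \<equiv> Gamma_eps e \<epsilon>"

lemma e_pos: "e \<ge> 1"
  using odd_e by (auto elim: oddE)

lemma \<epsilon>_neq_0 [simp]: "\<epsilon> \<noteq> 0"
  using \<epsilon>_notin by auto

lemma graded_eval_V_poly:
  "graded_eval v (V_poly e \<epsilon> 3) = monom (v 3 ^ q) q + monom (v 3) 1 -
    (Gamma_eps e [:\<epsilon>:] (monom (v 1) 1) + Gamma_eps e [:\<epsilon>:] (monom (v 2) 1))"
proof -
  have "{1..3 - 1} = {1, 2 :: nat}" by auto
  then show ?thesis
    by (simp add: V_poly_def graded_eval_diff graded_eval_add graded_eval_power graded_eval_var
        graded_eval_Gamma_eps monom_power q_def)
qed

lemma coeff_graded_eval_V_poly: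
  "coeff (graded_eval v (V_poly e \<epsilon> 3)) (q * (s + 2)) =
    (v 1 ^ q * \<epsilon>) ^ (s + 2) + (v 2 ^ q * \<epsilon>) ^ (s + 2)"
proof -
  have "coeff (Gamma_eps e [:\<epsilon>:] (monom c 1)) (q * (s + 2)) = (c ^ q * \<epsilon>) ^ (s + 2)" for c
    unfolding q_def s_def by (rule coeff_Gamma_eps[OF e_pos])
  moreover have "q * (s + 2) \<noteq> q" by simp
  moreover have "q * (s + 2) \<noteq> 1" by (simp only: nat_mult_eq_1_iff) simp
  ultimately show ?thesis
    unfolding graded_eval_V_poly coeff_add coeff_diff coeff_monom by auto
qed

lemma mp_total_degree_V_poly: "mp_total_degree (V_poly e \<epsilon> 3) = q * (s + 2)"
proof (rule antisym)
  have var: "mp_total_degree (mp_var 3 ^ n) \<le> q * (s + 2)" if "n \<le> q" for n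
  proof -
    have "n \<le> q * (s + 2)" using that by (simp add: trans_le_add1)
    then show ?thesis
      using order_trans[OF mp_total_degree_power_le[OF mp_total_degree_var_le, of 3 n]] by simp
  qed
  have "mp_total_degree (mp_var 3 :: 'a mpolynomial) \<le> q * (s + 2)"
    using var[of 1] by (simp add: Suc_le_eq)
  moreover have "mp_total_degree (Gamma_eps e (mp_const \<epsilon>) (mp_var i)) \<le> q * (s + 2)" for i
    unfolding q_def s_def by (rule mp_total_degree_Gamma_eps_le[OF e_pos])
  ultimately show "mp_total_degree (V_poly e \<epsilon> 3) \<le> q * (s + 2)"
    unfolding V_poly_def q_def[symmetric]
    by (intro mp_total_degree_diff_le mp_total_degree_add_le mp_total_degree_sum_le var) auto
  show "q * (s + 2) \<le> mp_total_degree (V_poly e \<epsilon> 3)"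
    \<comment> \<open>At this \<open>v\<close> the coefficient is
      \<open>\<epsilon> ^ (s + 2)\<close>, which is nonzero.\<close>
    by (rule le_mp_total_degree[where v = "\<lambda>i. if i = 1 then 1 else 0"])
      (unfold coeff_graded_eval_V_poly, simp add: power_0_left)
qed

text \<open>The equation at infinity is written as already reduced by injectivity of the power
  \<open>s + 2\<close>.\<close>

definition on_V :: "(nat \<Rightarrow> 'a) \<Rightarrow> bool" where
  "on_V v \<longleftrightarrow> (if v 0 = 0 then v 1 = v 2
     else tr (v 3 / v 0) = \<Gamma> (v 1 / v 0) + \<Gamma> (v 2 / v 0))"

lemma mp_eval_V_poly_eq_0_iff:
  assumes "[e = 1] (mod 4)"
  shows "mp_eval (mp_homogenize (V_poly e \<epsilon> 3)) v = 0 \<longleftrightarrow> on_V v"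
proof (cases "v 0 = 0")
  case True
  have "mp_eval (mp_homogenize (V_poly e \<epsilon> 3)) v = 0 \<longleftrightarrow>
      (v 1 ^ q * \<epsilon>) ^ (s + 2) = (v 2 ^ q * \<epsilon>) ^ (s + 2)"
    unfolding mp_eval_homogenize_at_infinity[of v, OF True] mp_total_degree_V_poly
      coeff_graded_eval_V_poly by (rule add_eq_0_iff_char2)
  also have "\<dots> \<longleftrightarrow> v 1 ^ q * \<epsilon> = v 2 ^ q * \<epsilon>"
    using power_s_add_2_inj[OF assms] by metis
  also have "\<dots> \<longleftrightarrow> v 1 = v 2" using q_q_power by (metis \<epsilon>_neq_0 mult_right_cancel)
  finally show ?thesis using True by (simp add: on_V_def)
next
  case False
  have "poly (graded_eval v (V_poly e \<epsilon> 3)) (1 / v 0) =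
      tr (v 3 / v 0) + (\<Gamma> (v 1 / v 0) + \<Gamma> (v 2 / v 0))"
    unfolding graded_eval_V_poly
    by (simp add: poly_Gamma_eps poly_monom tr_def power_divide)
  then show ?thesis
    using False by (simp add: mp_eval_homogenize_affine on_V_def add_eq_0_iff_char2)
qed

text \<open>The hypersurface demands vanishing at every coordinate vector of a point;
  \<open>on_V\<close> is invariant under scaling, so one vector decides.\<close>

lemma in_V_eps_iff:
  assumes "[e = 1] (mod 4)" "v \<in> carrier_vec 4" "v \<noteq> 0\<^sub>v 4"
  shows "proj_point v \<in> V_eps e \<epsilon> 3 \<longleftrightarrow> on_V (\<lambda>i. v $ i)"
proof -
  have "on_V (\<lambda>i. (l \<cdot>\<^sub>v v) $ i) \<longleftrightarrow> on_V (\<lambda>i. v $ i)" if "l \<noteq> 0" for l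
    using that carrier_vecD[OF assms(2)] by (simp add: on_V_def)
  moreover have "proj_point v \<in> PG 3" using assms(2,3) by (auto simp: PG_def)
  moreover have "\<exists>l::'a. l \<noteq> 0" by (rule exI[of _ 1]) simp
  ultimately show ?thesis
    unfolding V_eps_def proj_hypersurface_def
    by (auto simp: mp_eval_V_poly_eq_0_iff[OF assms(1)] proj_point_def)
qed

section \<open>Representatives of the rational points\<close>

definition affine_points :: "(('a \<times> 'a) \<times> 'a) set" where
  "affine_points = (SIGMA p:UNIV. {z. tr z = \<Gamma> (fst p) + \<Gamma> (snd p)})"

definition affine_vec :: "('a \<times> 'a) \<times> 'a \<Rightarrow> 'a vec" where
  "affine_vec t = vec4 1 (fst (fst t)) (snd (fst t)) (snd t)"

text \<open>Each point is normalized to have first nonzero coordinate 1; the last two pieces make up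
  the line \<open>X0 = 0, X1 = X2\<close>.\<close>

definition representatives :: "'a vec set" where
  "representatives = affine_vec ` affine_points \<union> (\<lambda>z. vec4 0 1 1 z) ` UNIV
     \<union> {vec4 0 0 0 1}"

lemma representatives_carrier: "representatives \<subseteq> carrier_vec 4"
  by (auto simp: representatives_def affine_vec_def)

lemma bij_betw_representatives:
  assumes e: "[e = 1] (mod 4)"
  shows "bij_betw proj_point representatives (V_eps e \<epsilon> 3)"
  unfolding bij_betw_def
proof
  show "inj_on proj_point representatives"
  proof (rule inj_onI)
    fix u v assume uv: "u \<in> representatives" "v \<in> representatives" "proj_point u = proj_point v"
    then obtain c where c: "c \<noteq> 0" "u = c \<cdot>\<^sub>v v" unfolding proj_point_eq_iff by blast
    have car: "u \<in> carrier_vec 4" "v \<in> carrier_vec 4" using uv representatives_carrier by auto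
    have i: "u $ i = c * v $ i" if "i < 4" for i using c car that by auto
    show "u = v"
      using uv(1,2) i[of 0] i[of 1] i[of 2] i[of 3] c(1)
      by (auto simp: representatives_def affine_vec_def)
  qed
  show "proj_point ` representatives = V_eps e \<epsilon> 3"
  proof (intro equalityI subsetI)
    fix P assume "P \<in> proj_point ` representatives"
    then obtain u where u: "u \<in> representatives" "P = proj_point u" by blast
    have car: "u \<in> carrier_vec 4" using u representatives_carrier by auto
    have "u \<noteq> 0\<^sub>v 4"
      using u(1) by (auto simp: representatives_def affine_vec_def carrier_vec4_eq_iff)
    moreover have "on_V (\<lambda>i. u $ i)"
      using u(1) by (auto simp: representatives_def affine_vec_def affine_points_def on_V_def)
    ultimately show "P \<in> V_eps e \<epsilon> 3" using in_V_eps_iff[OF e car] u(2) by blast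
  next
    fix P assume P: "P \<in> V_eps e \<epsilon> 3"
    then obtain v where v: "v \<in> carrier_vec 4" "v \<noteq> 0\<^sub>v 4" "P = proj_point v"
      by (auto simp: V_eps_def proj_hypersurface_def PG_def)
    then have on: "on_V (\<lambda>i. v $ i)" using P in_V_eps_iff[OF e] by blast
    have "\<exists>u\<in>representatives. \<exists>c. c \<noteq> 0 \<and> v = c \<cdot>\<^sub>v u"
    proof (cases "v $ 0 = 0")
      case False
      let ?t = "((v $ 1 / v $ 0, v $ 2 / v $ 0), v $ 3 / v $ 0)"
      have "?t \<in> affine_points" using on False by (simp add: on_V_def affine_points_def)
      then have "affine_vec ?t \<in> representatives" by (auto simp: representatives_def)
      moreover have "v = v $ 0 \<cdot>\<^sub>v affine_vec ?t"
        using v(1) False by (subst carrier_vec4_eq_iff) (auto simp: affine_vec_def)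
      ultimately show ?thesis using False by blast
    next
      case True
      then have 12: "v $ 1 = v $ 2" using on by (simp add: on_V_def)
      show ?thesis
      proof (cases "v $ 2 = 0")
        case False
        have "v = v $ 2 \<cdot>\<^sub>v vec4 0 1 1 (v $ 3 / v $ 2)"
          using v(1) True 12 False by (subst carrier_vec4_eq_iff) auto
        then show ?thesis using False by (auto simp: representatives_def)
      next
        case v2: True
        have "v = v $ 3 \<cdot>\<^sub>v vec4 0 0 0 1"
          using v(1) True 12 v2 by (subst carrier_vec4_eq_iff) auto
        moreover have "v $ 3 \<noteq> 0" using v True 12 v2 by (auto simp: carrier_vec4_eq_iff)
        ultimately show ?thesis by (auto simp: representatives_def)
      qed
    qed
    then show "P \<in> proj_point ` representatives"
      unfolding v(3) by (metis image_eqI proj_point_eq_iff)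
  qed
qed

section \<open>Counting points on and off planes\<close>

lemma card_affine_points_over: "card {t \<in> affine_points. Q (fst t)} = q * card {p. Q p}"
proof -
  have "{t \<in> affine_points. Q (fst t)} =
      (SIGMA p:{p. Q p}. {z. tr z = \<Gamma> (fst p) + \<Gamma> (snd p)})"
    by (auto simp: affine_points_def)
  \<comment> \<open>Every pair has exactly \<open>q\<close> lifts, as \<open>\<Gamma>\<close> takes
    its values in \<open>K\<close>.\<close>
  then show ?thesis by (simp add: card_SigmaI card_tr_fiber mult.commute)
qed

lemma card_affine_points: "card affine_points = q ^ 5"
  using card_affine_points_over[of "\<lambda>_. True"] card_cartesian_product[of "UNIV :: 'a set" "UNIV :: 'a set"]
  by (simp add: card_UNIV eval_nat_numeral)

lemma card_line:
  assumes "b \<noteq> 0 \<or> c \<noteq> (0 :: 'a)"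
  shows "card {p. a + b * fst p + c * snd p = 0} = q\<^sup>2"
proof (cases "c = 0")
  case True
  then have "b \<noteq> 0" using assms by simp
  then have "{p. a + b * fst p + c * snd p = 0} = {a / b} \<times> UNIV"
    using True by (auto simp: add_eq_0_iff_char2 field_simps)
  then show ?thesis by (simp add: card_cartesian_product card_UNIV)
next
  case False
  then have "{p. a + b * fst p + c * snd p = 0} = (\<lambda>x. (x, (a + b * x) / c)) ` UNIV"
    by (auto simp: add_eq_0_iff_char2 field_simps image_iff)
  moreover have "inj (\<lambda>x. (x, (a + b * x) / c))" by (rule injI) simp
  ultimately show ?thesis by (simp add: card_image card_UNIV)
qed

text \<open>The equation cuts out a line of \<open>q\<^sup>2\<close> pairs, each with
  \<open>q\<close> lifts.\<close>

lemma card_affine_points_vertical_plane: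
  assumes "c1 \<noteq> 0 \<or> c2 \<noteq> 0"
  shows "card {t \<in> affine_points. c0 + c1 * fst (fst t) + c2 * snd (fst t) = 0} = q ^ 3"
  using card_affine_points_over[of "\<lambda>p. c0 + c1 * fst p + c2 * snd p = 0"] card_line[OF assms]
  by (simp add: eval_nat_numeral)

text \<open>Solving for the last coordinate and taking its trace leaves the condition on pairs
  counted in \<open>card_Gamma_sum_fiber\<close>.\<close>

lemma card_affine_points_plane:
  assumes "c3 \<noteq> 0"
  shows "int (card {t \<in> affine_points. c0 + c1 * fst (fst t) + c2 * snd (fst t) + c3 * snd t = 0}) \<in>
    {int q ^ 3 - int q, int q ^ 3 + int q ^ 2 - int q}"
proof -
  define d0 d1 d2 where "d0 = c0 / c3" and "d1 = c1 / c3" and "d2 = c2 / c3"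
  let ?B = "{(x, y). \<Gamma> x + tr (d1 * x) + (\<Gamma> y + tr (d2 * y)) = tr d0}"
  let ?f = "\<lambda>p. (p, d0 + d1 * fst p + d2 * snd p)"
  have plane: "c0 + c1 * x + c2 * y + c3 * z = 0 \<longleftrightarrow> z = d0 + d1 * x + d2 * y" for x y z
    using assms by (auto simp: add_eq_0_iff_char2 d0_def d1_def d2_def field_simps)
  have "tr (d0 + d1 * x + d2 * y) = \<Gamma> x + \<Gamma> y \<longleftrightarrow>
      \<Gamma> x + tr (d1 * x) + (\<Gamma> y + tr (d2 * y)) = tr d0" for x y
  proof -
    have "tr (d0 + d1 * x + d2 * y) + (\<Gamma> x + \<Gamma> y) =
        \<Gamma> x + tr (d1 * x) + (\<Gamma> y + tr (d2 * y)) + tr d0"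
      by (simp add: tr_add ac_simps)
    then show ?thesis by (metis add_eq_0_iff_char2)
  qed
  then have "{t \<in> affine_points. c0 + c1 * fst (fst t) + c2 * snd (fst t) + c3 * snd t = 0} = ?f ` ?B"
    unfolding plane by (auto simp: affine_points_def image_iff)
  moreover have "card (?f ` ?B) = card ?B" by (intro card_image inj_onI) simp
  ultimately show ?thesis using card_Gamma_sum_fiber[OF tr_in_K[of d0], of d1 d2] by simp
qed

text \<open>The three kinds of representatives are counted separately; the last summand is the point
  (0, 0, 0, 1). Integers keep the subtraction exact.\<close>

lemma card_representatives_off_plane:
  assumes c: "c \<in> carrier_vec 4"
  shows "int (card {u \<in> representatives. c \<bullet> u \<noteq> 0}) =
    int q ^ 5
    - int (card {t \<in> affine_points. c $ 0 + c $ 1 * fst (fst t) + c $ 2 * snd (fst t) + c $ 3 * snd t = 0})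
    + int (card {z. c $ 1 + c $ 2 + c $ 3 * z \<noteq> 0})
    + (if c $ 3 = 0 then 0 else 1)"
proof -
  let ?l = "\<lambda>t. c $ 0 + c $ 1 * fst (fst t) + c $ 2 * snd (fst t) + c $ 3 * snd t"
  let ?inf = "\<lambda>z :: 'a. vec4 0 1 1 z"
  let ?X = "affine_vec ` {t \<in> affine_points. ?l t \<noteq> 0}"
  let ?Y = "?inf ` {z. c $ 1 + c $ 2 + c $ 3 * z \<noteq> 0}"
  let ?Z = "if c $ 3 = 0 then {} else {vec4 0 0 0 (1 :: 'a)}"
  have eq: "{u \<in> representatives. c \<bullet> u \<noteq> 0} = ?X \<union> ?Y \<union> ?Z"
    by (auto simp: representatives_def affine_vec_def scalar_prod_vec4[OF c])
  have neq: "affine_vec t \<noteq> ?inf z" "affine_vec t \<noteq> vec4 0 0 0 1"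
      "?inf z \<noteq> vec4 0 0 0 (1 :: 'a)" for t z
    by (auto simp: affine_vec_def carrier_vec4_eq_iff)
  have XY: "?X \<inter> ?Y = {}" using neq(1) by blast
  have "vec4 0 0 0 1 \<notin> ?X \<union> ?Y" using neq(2,3)[symmetric] by blast
  then have Z: "(?X \<union> ?Y) \<inter> ?Z = {}" by simp
  have fin: "finite ?X" "finite ?Y" "finite ?Z" by simp_all
  have "card (?X \<union> ?Y \<union> ?Z) = card ?X + card ?Y + card ?Z"
    by (simp only: card_Un_disjoint[OF finite_UnI[OF fin(1,2)] fin(3) Z]
        card_Un_disjoint[OF fin(1,2) XY])
  moreover have "card ?X = card {t \<in> affine_points. ?l t \<noteq> 0}"
    by (intro card_image inj_onI) (auto simp: affine_vec_def carrier_vec4_eq_iff prod_eq_iff)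
  moreover have "card ?Y = card {z. c $ 1 + c $ 2 + c $ 3 * z \<noteq> 0}"
    by (intro card_image inj_onI) (auto simp: carrier_vec4_eq_iff)
  moreover have "q ^ 5 = card {t \<in> affine_points. ?l t = 0} + card {t \<in> affine_points. ?l t \<noteq> 0}"
    unfolding card_affine_points[symmetric]
    by (subst card_Un_disjoint[symmetric]) (auto intro: arg_cong[where f = card])
  then have "int q ^ 5 =
      int (card {t \<in> affine_points. ?l t = 0}) + int (card {t \<in> affine_points. ?l t \<noteq> 0})"
    by (simp only: of_nat_add[symmetric] of_nat_power[symmetric])
  moreover have "card ?Z = (if c $ 3 = 0 then 0 else 1)" by simp
  ultimately show ?thesis unfolding eq by (simp only: of_nat_add) simp
qed

lemma card_representatives_off_plane_cases:
  assumes c: "c \<in> carrier_vec 4" "c \<noteq> 0\<^sub>v 4"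
  shows "int (card {u \<in> representatives. c \<bullet> u \<noteq> 0}) \<in>
    {int q ^ 5,
     int q ^ 5 - int q ^ 3,
     int q ^ 5 - int q ^ 3 + int q ^ 2,
     int q ^ 5 - int q ^ 3 + int q,
     int q ^ 5 - int q ^ 3 + int q ^ 2 + int q}"
proof (cases "c $ 3 = 0")
  case False
  have "c $ 1 + c $ 2 + c $ 3 * z \<noteq> 0 \<longleftrightarrow> z \<noteq> (c $ 1 + c $ 2) / c $ 3" for z
    using False by (auto simp: add_eq_0_iff_char2 field_simps)
  then have "{z. c $ 1 + c $ 2 + c $ 3 * z \<noteq> 0} = UNIV - {(c $ 1 + c $ 2) / c $ 3}" by auto
  then have "card {z. c $ 1 + c $ 2 + c $ 3 * z \<noteq> 0} = q\<^sup>2 - 1" by (simp add: card_UNIV)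
  moreover have "q\<^sup>2 \<ge> 1" by (simp add: Suc_le_eq)
  ultimately have "int (card {z. c $ 1 + c $ 2 + c $ 3 * z \<noteq> 0}) = int q ^ 2 - 1"
    by (simp add: of_nat_diff)
  \<comment> \<open>The line at infinity contributes \<open>(q\<^sup>2 - 1) + 1\<close>; the two
    affine counts then give the last two weights.\<close>
  then show ?thesis
    using card_affine_points_plane[OF False, of "c $ 0" "c $ 1" "c $ 2"] False
    by (auto simp: card_representatives_off_plane[OF c(1)])
next
  case c3: True
  show ?thesis
  proof (cases "c $ 1 = 0 \<and> c $ 2 = 0")
    case True
    \<comment> \<open>The plane is the hyperplane at infinity, so every affine point lies off it and
      no other point does.\<close>
    then have "c $ 0 \<noteq> 0" using c c3 by (auto simp: carrier_vec4_eq_iff)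
    then show ?thesis using True c3 by (simp add: card_representatives_off_plane[OF c(1)])
  next
    case False
    then have "card {t \<in> affine_points. c $ 0 + c $ 1 * fst (fst t) + c $ 2 * snd (fst t) = 0} = q ^ 3"
      using card_affine_points_vertical_plane by blast
    \<comment> \<open>The line at infinity lies in the plane if \<open>c $ 1 + c $ 2 = 0\<close>;
      otherwise all its \<open>q\<^sup>2\<close> points except (0, 0, 0, 1) lie off it.\<close>
    then show ?thesis
      using c3 by (cases "c $ 1 + c $ 2 = 0")
        (simp_all add: card_representatives_off_plane[OF c(1)] card_UNIV)
  qed
qed

end

theorem theorem3p4:
  fixes e q :: nat
    and \<epsilon> \<delta> :: "'a :: {finite, field}"
    and C :: "'a vec set"
    and w :: "'a vec"
  assumes "e \<ge> 3" and "odd e" and "[e = 1] (mod 4)"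
    and "q = 2 ^ e"
    and "card (UNIV :: 'a set) = q\<^sup>2"
    and "\<epsilon> \<notin> subfield_of_order q"
    and "\<delta> \<in> subfield_of_order q" and "\<delta> \<noteq> 1"
    and "absolute_trace e \<delta> = 1"
    and "\<epsilon>\<^sup>2 + \<epsilon> + \<delta> = 0"
    and "is_code_of_points 3 (V_eps e \<epsilon> 3) C"
    and "w \<in> C" and "w \<noteq> 0\<^sub>v (dim_vec w)"
  shows "int (hamming_weight w) \<in>
    {int q ^ 5,
     int q ^ 5 - int q ^ 3,
     int q ^ 5 - int q ^ 3 + int q ^ 2,
     int q ^ 5 - int q ^ 3 + int q,
     int q ^ 5 - int q ^ 3 + int q ^ 2 + int q}"
proof -
  interpret tits_field e q "2 ^ ((e + 1) div 2)" \<epsilon> \<delta>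
    using assms by unfold_locales auto
  obtain c where c: "c \<in> carrier_vec (3 + 1)"
    and weight: "hamming_weight w = card {u \<in> representatives. c \<bullet> u \<noteq> 0}"
    using hamming_weight_code_of_points[OF assms(11,12) bij_betw_representatives[OF assms(3)]]
      representatives_carrier by auto
  \<comment> \<open>The zero form would give weight 0, hence the zero codeword.\<close>
  have "c \<noteq> 0\<^sub>v 4"
  proof
    assume "c = 0\<^sub>v 4"
    then have "{u \<in> representatives. c \<bullet> u \<noteq> 0} = {}"
      using representatives_carrier by auto
    then show False using assms(13) weight hamming_weight_eq_0_iff by (metis card.empty)
  qed
  then show ?thesis
    unfolding weight using c by (intro card_representatives_off_plane_cases) auto
qed

end
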